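(* Let $k\in\mathbb{N}$. (1) If the transition system $(\mathit{Init},\delta,\mathit{Bad}_1)$ has a backwards (respectively, forwards) $k$-fenced inductive invariant $I_1$, and the transition system $(\mathit{Init},\delta,\mathit{Bad}_2)$ has a backwards (respectively, forwards) $k$-fenced inductive invariant $I_2$, then $I_1\wedge I_2$ is an inductive invariant for $(\mathit{Init},\delta,\mathit{Bad}_1\vee\mathit{Bad}_2)$, and it is also backwards (respectively, forwards) $k$-fenced. (2) If the transition system $(\mathit{Init}_1,\delta,\mathit{Bad})$ has a backwards (respectively, forwards) $k$-fenced inductive invariant $I_1$, and the transition system $(\mathit{Init}_2,\delta,\mathit{Bad})$ has a backwards (respectively, forwards) $k$-fenced inductive invariant $I_2$, then $I_1\vee I_2$ is an inductive invariant for $(\mathit{Init}_1\vee\mathit{Init}_2,\delta,\mathit{Bad})$, and it is also backwards (respectively, forwards) $k$-fenced.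
   Context: Transition systems. $\Sigma$ is a finite set of Boolean variables; a state is a valuation of $\Sigma$; a formula over $\Sigma$ is identified with the set of states satisfying it, and $\varphi\Longrightarrow\psi$ means that $\varphi\to\psi$ is valid. A transition system is a triple $(\mathit{Init},\delta,\mathit{Bad})$ with $\mathit{Init},\mathit{Bad}$ formulas over $\Sigma$ and $\delta$ a formula over $\Sigma\uplus\Sigma'$ ($\Sigma'$ a primed copy), describing pairs (pre-state, post-state). Standing assumptions: $\mathit{Init}\not\equiv\mathit{false}$, $\mathit{Bad}\not\equiv\mathit{true},\mathit{false}$, $\mathit{Init}\Longrightarrow\neg\mathit{Bad}$. An inductive invariant is a formula $I$ over $\Sigma$ with (i) $\mathit{Init}\Longrightarrow I$, (ii) $I\wedge\delta\Longrightarrow I'$, (iii) $I\Longrightarrow\neg\mathit{Bad}$, where $I'$ is $I$ with variables primed. $\delta^{\le k}(S)$ is the set of states reachable from some state in $S$ in at most $k$ steps of $\delta$; $(\delta^{-1})^{\le k}(\mathit{Bad})$ is the set of states from which some state of $\mathit{Bad}$ is reachable in at most $k$ steps. Two states are neighbors if they differ in exactly one variable. $\partial^+(I)=\{\sigma\models I : \sigma\text{ has a neighbor }\not\models I\}$ and $\partial^-(I)=\{\sigma\not\models I : \sigma \text{ has a neighbor } \models I\}$. An inductive invariant $I$ is forwards $k$-fenced if $\partial^+(I)\subseteq\delta^{\le k}(\mathit{Init})$, and backwards $k$-fenced if $\partial^-(I)\subseteq(\delta^{-1})^{\le k}(\mathit{Bad})$. *)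

theory Defs
  imports Main
begin

text \<open>
  The variables \<open>\<Sigma>\<close> are the elements of a finite type \<open>'v\<close>. A formula over \<open>\<Sigma>\<close> is its set of
  models and a formula over \<open>\<Sigma> \<uplus> \<Sigma>'\<close> is a set of pairs (pre-state, post-state), so that
  \<open>\<and>\<close>, \<open>\<or>\<close>, \<open>\<not>\<close> and \<open>\<Longrightarrow>\<close> are \<open>\<inter>\<close>, \<open>\<union>\<close>, complement and \<open>\<subseteq>\<close>.
\<close>

type_synonym 'v state = "'v \<Rightarrow> bool"

type_synonym 'v formula = "'v state set"

record 'v transition_system =
  Init :: "'v formula"
  Delta :: "('v state \<times> 'v state) set"
  Bad :: "'v formula"

abbreviation TS ::
    "'v formula \<Rightarrow> ('v state \<times> 'v state) set \<Rightarrow> 'v formula \<Rightarrow> 'v transition_system" where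
  "TS init \<delta> bad \<equiv> \<lparr>Init = init, Delta = \<delta>, Bad = bad\<rparr>"

text \<open>The standing assumptions on transition systems.\<close>

definition wf_ts :: "'v::finite transition_system \<Rightarrow> bool" where
  "wf_ts T \<longleftrightarrow> Init T \<noteq> {} \<and> Bad T \<noteq> UNIV \<and> Bad T \<noteq> {} \<and> Init T \<subseteq> - Bad T"

definition inductive_invariant :: "'v::finite transition_system \<Rightarrow> 'v formula \<Rightarrow> bool" where
  "inductive_invariant T I \<longleftrightarrow>
     Init T \<subseteq> I \<and>
     (\<forall>\<sigma> \<sigma>'. \<sigma> \<in> I \<and> (\<sigma>, \<sigma>') \<in> Delta T \<longrightarrow> \<sigma>' \<in> I) \<and>
     I \<subseteq> - Bad T"

definition reachable_from ::
    "('v state \<times> 'v state) set \<Rightarrow> nat \<Rightarrow> 'v formula \<Rightarrow> 'v formula" where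
  "reachable_from \<delta> k S = {\<tau>. \<exists>\<sigma>\<in>S. \<exists>j\<le>k. (\<sigma>, \<tau>) \<in> \<delta> ^^ j}"

definition can_reach ::
    "('v state \<times> 'v state) set \<Rightarrow> nat \<Rightarrow> 'v formula \<Rightarrow> 'v formula" where
  "can_reach \<delta> k S = {\<sigma>. \<exists>\<tau>\<in>S. \<exists>j\<le>k. (\<sigma>, \<tau>) \<in> \<delta> ^^ j}"

definition neighbors :: "'v state \<Rightarrow> 'v state \<Rightarrow> bool" where
  "neighbors \<sigma> \<tau> \<longleftrightarrow> (\<exists>!v. \<sigma> v \<noteq> \<tau> v)"

definition inner_boundary :: "'v formula \<Rightarrow> 'v formula" where
  "inner_boundary I = {\<sigma>. \<sigma> \<in> I \<and> (\<exists>\<tau>. neighbors \<sigma> \<tau> \<and> \<tau> \<notin> I)}"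

definition outer_boundary :: "'v formula \<Rightarrow> 'v formula" where
  "outer_boundary I = {\<sigma>. \<sigma> \<notin> I \<and> (\<exists>\<tau>. neighbors \<sigma> \<tau> \<and> \<tau> \<in> I)}"

definition forwards_fenced :: "'v::finite transition_system \<Rightarrow> nat \<Rightarrow> 'v formula \<Rightarrow> bool" where
  "forwards_fenced T k I \<longleftrightarrow> inner_boundary I \<subseteq> reachable_from (Delta T) k (Init T)"

definition backwards_fenced :: "'v::finite transition_system \<Rightarrow> nat \<Rightarrow> 'v formula \<Rightarrow> bool" where
  "backwards_fenced T k I \<longleftrightarrow> outer_boundary I \<subseteq> can_reach (Delta T) k (Bad T)"

end

theory Submission
  imports Defs
begin

text \<open>
  A neighbor pair that crosses the border of \<open>I\<^sub>1 \<inter> I\<^sub>2\<close> or \<open>I\<^sub>1 \<union> I\<^sub>2\<close> also crosses, in the same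
  direction, the border of \<open>I\<^sub>1\<close> or of \<open>I\<^sub>2\<close>, so the boundaries of the combined invariant are covered
  by those of its parts; and the bounded reachability sets are monotone in their source or target.
\<close>

lemma inner_boundary_Int: "inner_boundary (A \<inter> B) \<subseteq> inner_boundary A \<union> inner_boundary B"
  unfolding inner_boundary_def by blast

text \<open>The neighbor lies outside both sets, so it witnesses the boundary of whichever set
  contains the state.\<close>

lemma inner_boundary_Un: "inner_boundary (A \<union> B) \<subseteq> inner_boundary A \<union> inner_boundary B"
  unfolding inner_boundary_def by blast

text \<open>The outer boundary of a set is the inner boundary of its complement, so by De Morgan
  this is \<open>inner_boundary_Un\<close> for complements, and \<open>outer_boundary_Un\<close> is
  likewise dual to \<open>inner_boundary_Int\<close>.\<close>

lemma outer_boundary_Int: "outer_boundary (A \<inter> B) \<subseteq> outer_boundary A \<union> outer_boundary B"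
  unfolding outer_boundary_def by blast

lemma outer_boundary_Un: "outer_boundary (A \<union> B) \<subseteq> outer_boundary A \<union> outer_boundary B"
  unfolding outer_boundary_def by blast

lemma reachable_from_Un:
  "reachable_from \<delta> k (S \<union> T) = reachable_from \<delta> k S \<union> reachable_from \<delta> k T"
  unfolding reachable_from_def by blast

lemma can_reach_Un: "can_reach \<delta> k (S \<union> T) = can_reach \<delta> k S \<union> can_reach \<delta> k T"
  unfolding can_reach_def by blast

text \<open>Two proper subsets may cover the whole state space; here they cannot, because the common
  \<open>init\<close> is nonempty and disjoint from both.\<close>

lemma wf_ts_Un_Bad:
  assumes "wf_ts (TS init \<delta> bad\<^sub>1)" "wf_ts (TS init \<delta> bad\<^sub>2)"
  shows "wf_ts (TS init \<delta> (bad\<^sub>1 \<union> bad\<^sub>2))"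
  using assms unfolding wf_ts_def by auto

lemma wf_ts_Un_Init:
  assumes "wf_ts (TS init\<^sub>1 \<delta> bad)" "wf_ts (TS init\<^sub>2 \<delta> bad)"
  shows "wf_ts (TS (init\<^sub>1 \<union> init\<^sub>2) \<delta> bad)"
  using assms unfolding wf_ts_def by auto

lemma inductive_invariant_Int:
  assumes "inductive_invariant (TS init \<delta> bad\<^sub>1) I\<^sub>1" "inductive_invariant (TS init \<delta> bad\<^sub>2) I\<^sub>2"
  shows "inductive_invariant (TS init \<delta> (bad\<^sub>1 \<union> bad\<^sub>2)) (I\<^sub>1 \<inter> I\<^sub>2)"
  using assms unfolding inductive_invariant_def by (simp; blast)

text \<open>Both systems share \<delta>, so a step from the union stays in whichever invariant held
  before it; safety survives because both invariants avoid the same \<open>bad\<close>.\<close>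

lemma inductive_invariant_Un:
  assumes "inductive_invariant (TS init\<^sub>1 \<delta> bad) I\<^sub>1" "inductive_invariant (TS init\<^sub>2 \<delta> bad) I\<^sub>2"
  shows "inductive_invariant (TS (init\<^sub>1 \<union> init\<^sub>2) \<delta> bad) (I\<^sub>1 \<union> I\<^sub>2)"
  using assms unfolding inductive_invariant_def by (simp; blast)

text \<open>An outer boundary state of the intersection reaches \<open>bad\<^sub>1\<close> or
  \<open>bad\<^sub>2\<close> within the same bound \<open>k\<close>, depending on whose boundary it
  lies on; either target is part of the enlarged one.\<close>

lemma backwards_fenced_Int:
  assumes "backwards_fenced (TS init \<delta> bad\<^sub>1) k I\<^sub>1" "backwards_fenced (TS init \<delta> bad\<^sub>2) k I\<^sub>2"
  shows "backwards_fenced (TS init \<delta> (bad\<^sub>1 \<union> bad\<^sub>2)) k (I\<^sub>1 \<inter> I\<^sub>2)"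
  using assms outer_boundary_Int[of I\<^sub>1 I\<^sub>2]
  unfolding backwards_fenced_def by (simp add: can_reach_Un; blast)

text \<open>The initial states are common to both systems, so both inner boundaries are already
  covered by one and the same reachability set.\<close>

lemma forwards_fenced_Int:
  assumes "forwards_fenced (TS init \<delta> bad\<^sub>1) k I\<^sub>1" "forwards_fenced (TS init \<delta> bad\<^sub>2) k I\<^sub>2"
  shows "forwards_fenced (TS init \<delta> (bad\<^sub>1 \<union> bad\<^sub>2)) k (I\<^sub>1 \<inter> I\<^sub>2)"
  using assms inner_boundary_Int[of I\<^sub>1 I\<^sub>2]
  unfolding forwards_fenced_def by (simp; blast)

lemma backwards_fenced_Un:
  assumes "backwards_fenced (TS init\<^sub>1 \<delta> bad) k I\<^sub>1" "backwards_fenced (TS init\<^sub>2 \<delta> bad) k I\<^sub>2"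
  shows "backwards_fenced (TS (init\<^sub>1 \<union> init\<^sub>2) \<delta> bad) k (I\<^sub>1 \<union> I\<^sub>2)"
  using assms outer_boundary_Un[of I\<^sub>1 I\<^sub>2]
  unfolding backwards_fenced_def by (simp; blast)

text \<open>Here the sources differ: each inner boundary is reached from its own initial set, and
  \<open>reachable_from_Un\<close> merges the two covers.\<close>

lemma forwards_fenced_Un:
  assumes "forwards_fenced (TS init\<^sub>1 \<delta> bad) k I\<^sub>1" "forwards_fenced (TS init\<^sub>2 \<delta> bad) k I\<^sub>2"
  shows "forwards_fenced (TS (init\<^sub>1 \<union> init\<^sub>2) \<delta> bad) k (I\<^sub>1 \<union> I\<^sub>2)"
  using assms inner_boundary_Un[of I\<^sub>1 I\<^sub>2]
  unfolding forwards_fenced_def by (simp add: reachable_from_Un; blast)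

theorem mainTheorem12:
  fixes k :: nat and \<delta> :: "('v::finite state \<times> 'v state) set"
  shows "((\<forall>init bad\<^sub>1 bad\<^sub>2 I\<^sub>1 I\<^sub>2.
        wf_ts (TS init \<delta> bad\<^sub>1) \<and>
        inductive_invariant (TS init \<delta> bad\<^sub>1) I\<^sub>1 \<and>
        backwards_fenced (TS init \<delta> bad\<^sub>1) k I\<^sub>1 \<and>
        wf_ts (TS init \<delta> bad\<^sub>2) \<and>
        inductive_invariant (TS init \<delta> bad\<^sub>2) I\<^sub>2 \<and>
        backwards_fenced (TS init \<delta> bad\<^sub>2) k I\<^sub>2
      \<longrightarrow>
        wf_ts (TS init \<delta> (bad\<^sub>1 \<union> bad\<^sub>2)) \<and>
        inductive_invariant (TS init \<delta> (bad\<^sub>1 \<union> bad\<^sub>2)) (I\<^sub>1 \<inter> I\<^sub>2) \<and>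
        backwards_fenced (TS init \<delta> (bad\<^sub>1 \<union> bad\<^sub>2)) k (I\<^sub>1 \<inter> I\<^sub>2)) \<and>
     (\<forall>init bad\<^sub>1 bad\<^sub>2 I\<^sub>1 I\<^sub>2.
        wf_ts (TS init \<delta> bad\<^sub>1) \<and>
        inductive_invariant (TS init \<delta> bad\<^sub>1) I\<^sub>1 \<and>
        forwards_fenced (TS init \<delta> bad\<^sub>1) k I\<^sub>1 \<and>
        wf_ts (TS init \<delta> bad\<^sub>2) \<and>
        inductive_invariant (TS init \<delta> bad\<^sub>2) I\<^sub>2 \<and>
        forwards_fenced (TS init \<delta> bad\<^sub>2) k I\<^sub>2
      \<longrightarrow>
        wf_ts (TS init \<delta> (bad\<^sub>1 \<union> bad\<^sub>2)) \<and>
        inductive_invariant (TS init \<delta> (bad\<^sub>1 \<union> bad\<^sub>2)) (I\<^sub>1 \<inter> I\<^sub>2) \<and>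
        forwards_fenced (TS init \<delta> (bad\<^sub>1 \<union> bad\<^sub>2)) k (I\<^sub>1 \<inter> I\<^sub>2))) \<and>
    ((\<forall>init\<^sub>1 init\<^sub>2 bad I\<^sub>1 I\<^sub>2.
        wf_ts (TS init\<^sub>1 \<delta> bad) \<and>
        inductive_invariant (TS init\<^sub>1 \<delta> bad) I\<^sub>1 \<and>
        backwards_fenced (TS init\<^sub>1 \<delta> bad) k I\<^sub>1 \<and>
        wf_ts (TS init\<^sub>2 \<delta> bad) \<and>
        inductive_invariant (TS init\<^sub>2 \<delta> bad) I\<^sub>2 \<and>
        backwards_fenced (TS init\<^sub>2 \<delta> bad) k I\<^sub>2
      \<longrightarrow>
        wf_ts (TS (init\<^sub>1 \<union> init\<^sub>2) \<delta> bad) \<and>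
        inductive_invariant (TS (init\<^sub>1 \<union> init\<^sub>2) \<delta> bad) (I\<^sub>1 \<union> I\<^sub>2) \<and>
        backwards_fenced (TS (init\<^sub>1 \<union> init\<^sub>2) \<delta> bad) k (I\<^sub>1 \<union> I\<^sub>2)) \<and>
     (\<forall>init\<^sub>1 init\<^sub>2 bad I\<^sub>1 I\<^sub>2.
        wf_ts (TS init\<^sub>1 \<delta> bad) \<and>
        inductive_invariant (TS init\<^sub>1 \<delta> bad) I\<^sub>1 \<and>
        forwards_fenced (TS init\<^sub>1 \<delta> bad) k I\<^sub>1 \<and>
        wf_ts (TS init\<^sub>2 \<delta> bad) \<and>
        inductive_invariant (TS init\<^sub>2 \<delta> bad) I\<^sub>2 \<and>
        forwards_fenced (TS init\<^sub>2 \<delta> bad) k I\<^sub>2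
      \<longrightarrow>
        wf_ts (TS (init\<^sub>1 \<union> init\<^sub>2) \<delta> bad) \<and>
        inductive_invariant (TS (init\<^sub>1 \<union> init\<^sub>2) \<delta> bad) (I\<^sub>1 \<union> I\<^sub>2) \<and>
        forwards_fenced (TS (init\<^sub>1 \<union> init\<^sub>2) \<delta> bad) k (I\<^sub>1 \<union> I\<^sub>2)))"
  \<comment> \<open>Splitting leaves three goals for each of the four cases (well-formedness,
    invariance, fencing), each an instance of one lemma above.\<close>
  by (intro conjI allI impI;
      blast intro: wf_ts_Un_Bad wf_ts_Un_Init inductive_invariant_Int inductive_invariant_Un
        backwards_fenced_Int backwards_fenced_Un forwards_fenced_Int forwards_fenced_Un)

end
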